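(* Let $G$ be a connected, locally finite metric graph. If $G$ is $\delta$-hyperbolic for some $\delta\ge 0$, then there exist constants $\varepsilon>0$ and $k\ge 0$ such that $G$ is $\varepsilon$-densely $k$-path-chordal.
   Context: A metric graph is a graph $G$ in which every edge $e$ is regarded as isometric to an interval $[0,l_e]$ (no restriction on the lengths); interior points of edges are points of $G$, and $d(x,y)$ is the length of a shortest path joining $x,y$. A geodesic triangle is a union of three geodesics $[x_1x_2],[x_2x_3],[x_3x_1]$; it is $\delta$-thin if each side lies in the $\delta$-neighborhood of the union of the other two; $G$ is $\delta$-hyperbolic if every geodesic triangle is $\delta$-thin. A cycle is a simple closed curve in $G$ (closed path through vertices all distinct except first and last); $d_C$ is the length metric on a cycle $C$ and $L(\cdot)$ is length. A shortcut in a cycle $C$ is a path $\sigma$ joining two vertices $p,q$ of $C$ with $L(\sigma)<d_C(p,q)$; it is strict if $\sigma\cap C=\{p,q\}$, and then $p,q$ are the shortcut vertices associated to $\sigma$. A subset $A$ of a metric space $X$ is $\varepsilon$-dense if every $x\in X$ has some $a\in A$ with $d(a,x)<\varepsilon$. $G$ is $\varepsilon$-densely $k$-path-chordal if for every cycle $C$ with $L(C)\ge k$ there exist strict shortcuts $\sigma_1,\dots,\sigma_r$ of $C$ (with no bound on their lengths) whose associated shortcut vertices form an $\varepsilon$-dense subset of $(C,d_C)$. *)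

theory Defs
  imports Complex_Main
begin

text \<open>
  Graphs are undirected; loops and multiple edges are allowed. The functions \<open>tail\<close> and \<open>head\<close>
  only fix, for every edge \<open>e\<close>, the direction in which it is parametrized by \<open>[0, elen e]\<close>.
\<close>

record ('v, 'e) mgraph =
  verts :: "'v set"
  edges :: "'e set"
  tail :: "'e \<Rightarrow> 'v"
  head :: "'e \<Rightarrow> 'v"
  elen :: "'e \<Rightarrow> real"

datatype ('v, 'e) point = Vertex 'v | Inner 'e real

definition points :: "('v, 'e) mgraph \<Rightarrow> ('v, 'e) point set" where
  "points G = Vertex ` verts G \<union> {Inner e t | e t. e \<in> edges G \<and> 0 < t \<and> t < elen G e}"

definition edge_point :: "('v, 'e) mgraph \<Rightarrow> 'e \<Rightarrow> real \<Rightarrow> ('v, 'e) point" where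
  "edge_point G e t =
    (if t = 0 then Vertex (tail G e) else if t = elen G e then Vertex (head G e) else Inner e t)"

text \<open>
  A path is a finite concatenation of segments; the segment \<open>(e, s, t)\<close> runs inside the edge \<open>e\<close>
  from parameter \<open>s\<close> to parameter \<open>t\<close> (in either direction). Paths may thus start and end at
  interior points of edges. The empty list is the constant path.
\<close>

fun path_between ::
  "('v, 'e) mgraph \<Rightarrow> ('v, 'e) point \<Rightarrow> ('e \<times> real \<times> real) list \<Rightarrow> ('v, 'e) point \<Rightarrow> bool" where
  "path_between G x [] y \<longleftrightarrow> x \<in> points G \<and> x = y"
| "path_between G x ((e, s, t) # \<sigma>) y \<longleftrightarrow>
     e \<in> edges G \<and> s \<in> {0..elen G e} \<and> t \<in> {0..elen G e} \<and>
     x = edge_point G e s \<and> path_between G (edge_point G e t) \<sigma> y"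

definition path_length :: "('e \<times> real \<times> real) list \<Rightarrow> real" where
  "path_length \<sigma> = (\<Sum>(e, s, t)\<leftarrow>\<sigma>. \<bar>t - s\<bar>)"

definition path_trace ::
  "('v, 'e) mgraph \<Rightarrow> ('v, 'e) point \<Rightarrow> ('e \<times> real \<times> real) list \<Rightarrow> ('v, 'e) point set" where
  "path_trace G x \<sigma> = insert x (\<Union>(e, s, t)\<in>set \<sigma>. edge_point G e ` {min s t..max s t})"

definition gdist :: "('v, 'e) mgraph \<Rightarrow> ('v, 'e) point \<Rightarrow> ('v, 'e) point \<Rightarrow> real" where
  "gdist G x y = Inf {path_length \<sigma> | \<sigma>. path_between G x \<sigma> y}"

text \<open>
  The last clause says that the distance is the length of a \<^emph>\<open>shortest\<close> path, i.e. that the infimum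
  in \<open>gdist\<close> is attained. It is not automatic when all degrees are finite, because edge lengths
  need not be bounded away from 0; it is automatic if every ball meets only finitely many edges.
\<close>

definition metric_graph :: "('v, 'e) mgraph \<Rightarrow> bool" where
  "metric_graph G \<longleftrightarrow>
     (\<forall>e\<in>edges G. tail G e \<in> verts G \<and> head G e \<in> verts G \<and> 0 < elen G e) \<and>
     (\<forall>x\<in>points G. \<forall>y\<in>points G. (\<exists>\<sigma>. path_between G x \<sigma> y) \<longrightarrow>
        (\<exists>\<sigma>. path_between G x \<sigma> y \<and> (\<forall>\<tau>. path_between G x \<tau> y \<longrightarrow> path_length \<sigma> \<le> path_length \<tau>)))"

definition connected_graph :: "('v, 'e) mgraph \<Rightarrow> bool" where
  "connected_graph G \<longleftrightarrow> (\<forall>x\<in>points G. \<forall>y\<in>points G. \<exists>\<sigma>. path_between G x \<sigma> y)"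

definition locally_finite_graph :: "('v, 'e) mgraph \<Rightarrow> bool" where
  "locally_finite_graph G \<longleftrightarrow> (\<forall>v\<in>verts G. finite {e \<in> edges G. tail G e = v \<or> head G e = v})"

definition geodesic :: "'p set \<Rightarrow> ('p \<Rightarrow> 'p \<Rightarrow> real) \<Rightarrow> 'p \<Rightarrow> 'p \<Rightarrow> 'p set \<Rightarrow> bool" where
  "geodesic M d x y S \<longleftrightarrow>
     (\<exists>g. g 0 = x \<and> g (d x y) = y \<and> g ` {0..d x y} = S \<and> S \<subseteq> M \<and>
        (\<forall>s\<in>{0..d x y}. \<forall>t\<in>{0..d x y}. d (g s) (g t) = \<bar>s - t\<bar>))"

definition neighborhood :: "'p set \<Rightarrow> ('p \<Rightarrow> 'p \<Rightarrow> real) \<Rightarrow> real \<Rightarrow> 'p set \<Rightarrow> 'p set" where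
  "neighborhood M d \<delta> A = {p \<in> M. \<exists>a\<in>A. d p a \<le> \<delta>}"

definition thin_triangle :: "'p set \<Rightarrow> ('p \<Rightarrow> 'p \<Rightarrow> real) \<Rightarrow> real \<Rightarrow> 'p set \<Rightarrow> 'p set \<Rightarrow> 'p set \<Rightarrow> bool" where
  "thin_triangle M d \<delta> A B C \<longleftrightarrow>
     A \<subseteq> neighborhood M d \<delta> (B \<union> C) \<and>
     B \<subseteq> neighborhood M d \<delta> (C \<union> A) \<and>
     C \<subseteq> neighborhood M d \<delta> (A \<union> B)"

definition hyperbolic :: "'p set \<Rightarrow> ('p \<Rightarrow> 'p \<Rightarrow> real) \<Rightarrow> real \<Rightarrow> bool" where
  "hyperbolic M d \<delta> \<longleftrightarrow>
     (\<forall>x1\<in>M. \<forall>x2\<in>M. \<forall>x3\<in>M. \<forall>A B C.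
        geodesic M d x1 x2 A \<and> geodesic M d x2 x3 B \<and> geodesic M d x3 x1 C \<longrightarrow>
        thin_triangle M d \<delta> A B C)"

definition eps_dense :: "'p set \<Rightarrow> ('p \<Rightarrow> 'p \<Rightarrow> real) \<Rightarrow> real \<Rightarrow> 'p set \<Rightarrow> bool" where
  "eps_dense X d \<epsilon> A \<longleftrightarrow> A \<subseteq> X \<and> (\<forall>x\<in>X. \<exists>a\<in>A. d a x < \<epsilon>)"

text \<open>
  A cycle is a cyclic list of edges, each with a flag that is \<open>True\<close> iff the edge is traversed
  from its tail to its head. Distinctness of the edges only matters for the two-vertex case, where
  it excludes running back and forth along a single edge.
\<close>

definition step_start :: "('v, 'e) mgraph \<Rightarrow> 'e \<times> bool \<Rightarrow> 'v" where
  "step_start G = (\<lambda>(e, b). if b then tail G e else head G e)"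

definition step_end :: "('v, 'e) mgraph \<Rightarrow> 'e \<times> bool \<Rightarrow> 'v" where
  "step_end G = (\<lambda>(e, b). if b then head G e else tail G e)"

definition is_cycle :: "('v, 'e) mgraph \<Rightarrow> ('e \<times> bool) list \<Rightarrow> bool" where
  "is_cycle G c \<longleftrightarrow>
     c \<noteq> [] \<and> fst ` set c \<subseteq> edges G \<and>
     (\<forall>i<length c. step_end G (c ! i) = step_start G (c ! (Suc i mod length c))) \<and>
     distinct (map (step_start G) c) \<and> distinct (map fst c)"

definition cycle_length :: "('v, 'e) mgraph \<Rightarrow> ('e \<times> bool) list \<Rightarrow> real" where
  "cycle_length G c = (\<Sum>(e, b)\<leftarrow>c. elen G e)"

text \<open>
  The cycle regarded as a metric graph of its own: \<open>points (cycle_graph G c)\<close> is \<open>C\<close> as a subset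
  of \<open>points G\<close>, and \<open>gdist (cycle_graph G c)\<close> is \<open>d\<^sub>C\<close>.
\<close>

definition cycle_graph :: "('v, 'e) mgraph \<Rightarrow> ('e \<times> bool) list \<Rightarrow> ('v, 'e) mgraph" where
  "cycle_graph G c = G\<lparr>verts := step_start G ` set c, edges := fst ` set c\<rparr>"

definition shortcut ::
  "('v, 'e) mgraph \<Rightarrow> ('e \<times> bool) list \<Rightarrow> 'v \<Rightarrow> ('e \<times> real \<times> real) list \<Rightarrow> 'v \<Rightarrow> bool" where
  "shortcut G c p \<sigma> q \<longleftrightarrow>
     p \<in> verts (cycle_graph G c) \<and> q \<in> verts (cycle_graph G c) \<and>
     path_between G (Vertex p) \<sigma> (Vertex q) \<and>
     path_length \<sigma> < gdist (cycle_graph G c) (Vertex p) (Vertex q)"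

definition strict_shortcut ::
  "('v, 'e) mgraph \<Rightarrow> ('e \<times> bool) list \<Rightarrow> 'v \<Rightarrow> ('e \<times> real \<times> real) list \<Rightarrow> 'v \<Rightarrow> bool" where
  "strict_shortcut G c p \<sigma> q \<longleftrightarrow>
     shortcut G c p \<sigma> q \<and>
     path_trace G (Vertex p) \<sigma> \<inter> points (cycle_graph G c) = {Vertex p, Vertex q}"

definition densely_path_chordal :: "('v, 'e) mgraph \<Rightarrow> real \<Rightarrow> real \<Rightarrow> bool" where
  "densely_path_chordal G \<epsilon> k \<longleftrightarrow>
     (\<forall>c. is_cycle G c \<and> cycle_length G c \<ge> k \<longrightarrow>
        (\<exists>\<Sigma>. finite \<Sigma> \<and> (\<forall>(p, \<sigma>, q)\<in>\<Sigma>. strict_shortcut G c p \<sigma> q) \<and>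
           eps_dense (points (cycle_graph G c)) (gdist (cycle_graph G c)) \<epsilon>
             (\<Union>(p, \<sigma>, q)\<in>\<Sigma>. {Vertex p, Vertex q})))"

end

theory Submission
  imports Defs
begin

text \<open>
  Let \<open>t > \<delta>\<close>, let \<open>C\<close> be a cycle with \<open>L(C) \<ge> 4t\<close>, and suppose that no strict shortcut of \<open>C\<close> has a
  vertex at \<open>d\<^sub>C\<close>-distance less than \<open>3t\<close> from some \<open>x \<in> C\<close>. A geodesic of the graph starting near \<open>x\<close> cannot
  gain anything over \<open>C\<close> by leaving it, so near \<open>x\<close> the distance is \<open>d\<^sub>C\<close>. In particular the points
  \<open>a\<close>, \<open>b\<close> of \<open>C\<close> at distance \<open>t\<close> from \<open>x\<close> on its two sides satisfy \<open>d(a, b) = 2t\<close>, and every point of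
  the complementary arc is joined to \<open>x\<close> by a geodesic through \<open>a\<close> or through \<open>b\<close>. By the
  intermediate value theorem some \<open>y\<close> on this arc is equidistant from \<open>a\<close> and \<open>b\<close>, hence joined to \<open>x\<close>
  by geodesics of both kinds. Thinness of this bigon gives \<open>d(a, b) \<le> 2\<delta> < 2t\<close>, a contradiction.
\<close>

section \<open>Paths and distances\<close>

text \<open>Without connectedness, so that path concatenation is already available for a cycle
  viewed as a graph of its own, whose connectedness is proved with it.\<close>

locale incidence_graph =
  fixes G :: "('v, 'e) mgraph"
  assumes incidence: "e \<in> edges G \<Longrightarrow> tail G e \<in> verts G \<and> head G e \<in> verts G \<and> 0 < elen G e"
begin

lemma edge_point_in_points:
  assumes "e \<in> edges G" "t \<in> {0..elen G e}"
  shows "edge_point G e t \<in> points G"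
  using assms incidence[OF assms(1)] by (auto simp: edge_point_def points_def)

lemma path_between_endpoints:
  "path_between G x \<sigma> y \<Longrightarrow> x \<in> points G \<and> y \<in> points G"
proof (induction \<sigma> arbitrary: x)
  case Nil
  then show ?case by auto
next
  case (Cons a \<sigma>)
  then show ?case by (cases a) (auto intro: edge_point_in_points)
qed

lemma path_between_append:
  "path_between G x (\<sigma> @ \<tau>) z \<longleftrightarrow> (\<exists>y. path_between G x \<sigma> y \<and> path_between G y \<tau> z)"
proof (induction \<sigma> arbitrary: x)
  case Nil
  then show ?case using path_between_endpoints by auto
next
  case (Cons a \<sigma>)
  then show ?case by (cases a) auto
qed

lemma path_between_segment:
  assumes "e \<in> edges G" "s \<in> {0..elen G e}" "t \<in> {0..elen G e}"
  shows "path_between G (edge_point G e s) [(e, s, t)] (edge_point G e t)"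
  using assms edge_point_in_points by auto

lemma path_between_rev:
  "path_between G x \<sigma> y \<Longrightarrow> path_between G y (rev (map (\<lambda>(e, s, t). (e, t, s)) \<sigma>)) x"
proof (induction \<sigma> arbitrary: x)
  case Nil
  then show ?case by auto
next
  case (Cons a \<sigma>)
  then show ?case
    using edge_point_in_points by (cases a) (auto simp: path_between_append)
qed

end

lemma path_length_simps [simp]:
  "path_length [] = 0"
  "path_length ((e, s, t) # \<sigma>) = \<bar>t - s\<bar> + path_length \<sigma>"
  "path_length (\<sigma> @ \<tau>) = path_length \<sigma> + path_length \<tau>"
  by (auto simp: path_length_def)

lemma path_length_nonneg: "0 \<le> path_length \<sigma>"
  by (induction \<sigma>) auto

lemma path_length_rev: "path_length (rev (map (\<lambda>(e, s, t). (e, t, s)) \<sigma>)) = path_length \<sigma>"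
  by (induction \<sigma>) auto

lemma gdist_le_path_length:
  assumes "path_between G x \<sigma> y"
  shows "gdist G x y \<le> path_length \<sigma>"
  unfolding gdist_def
  by (rule cInf_lower) (use assms in \<open>auto intro!: bdd_belowI[of _ 0] path_length_nonneg\<close>)

locale length_graph = incidence_graph +
  assumes connected: "connected_graph G"
begin

lemma le_gdist:
  assumes "x \<in> points G" "y \<in> points G"
    and "\<And>\<sigma>. path_between G x \<sigma> y \<Longrightarrow> r \<le> path_length \<sigma>"
  shows "r \<le> gdist G x y"
  unfolding gdist_def
  by (rule cInf_greatest) (use assms connected in \<open>auto simp: connected_graph_def\<close>)

lemma gdist_nonneg:
  assumes "x \<in> points G" "y \<in> points G"
  shows "0 \<le> gdist G x y"
  using assms by (rule le_gdist) (rule path_length_nonneg)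

lemma gdist_self [simp]:
  assumes "x \<in> points G"
  shows "gdist G x x = 0"
  using gdist_le_path_length[of G x "[]" x] gdist_nonneg[OF assms assms] assms by simp

lemma gdist_commute:
  assumes "x \<in> points G" "y \<in> points G"
  shows "gdist G x y = gdist G y x"
proof -
  have "gdist G x y \<le> gdist G y x" if "x \<in> points G" "y \<in> points G" for x y
    using that(2,1)
    by (rule le_gdist) (metis gdist_le_path_length path_between_rev path_length_rev)
  with assms show ?thesis by (meson order_antisym)
qed

lemma gdist_triangle:
  assumes "x \<in> points G" "y \<in> points G" "z \<in> points G"
  shows "gdist G x z \<le> gdist G x y + gdist G y z"
proof -
  \<comment> \<open>Infimum over the second leg with the first leg fixed; the first leg is varied
    afterwards.\<close>
  have "gdist G x z - path_length \<sigma> \<le> gdist G y z" if \<sigma>: "path_between G x \<sigma> y" for \<sigma>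
  proof (rule le_gdist[OF assms(2,3)])
    fix \<tau> assume "path_between G y \<tau> z"
    with \<sigma> have "path_between G x (\<sigma> @ \<tau>) z" by (auto simp: path_between_append)
    from gdist_le_path_length[OF this] show "gdist G x z - path_length \<sigma> \<le> path_length \<tau>"
      by simp
  qed
  then have "gdist G x z - gdist G y z \<le> gdist G x y"
    by (intro le_gdist[OF assms(1,2)]) force
  then show ?thesis by simp
qed

lemma gdist_edge_point:
  assumes "e \<in> edges G" "s \<in> {0..elen G e}" "t \<in> {0..elen G e}"
  shows "gdist G (edge_point G e s) (edge_point G e t) \<le> \<bar>t - s\<bar>"
  using gdist_le_path_length[OF path_between_segment[OF assms]] by simp

end

section \<open>Geodesics\<close>

text \<open>Asking only for the upper bound makes such curves closed under concatenation; geodesics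
  are recovered when \<open>l\<close> is the distance of the end points.\<close>

definition lipschitz_curve ::
  "'p set \<Rightarrow> ('p \<Rightarrow> 'p \<Rightarrow> real) \<Rightarrow> 'p \<Rightarrow> 'p \<Rightarrow> real \<Rightarrow> (real \<Rightarrow> 'p) \<Rightarrow> bool" where
  "lipschitz_curve M d x y l g \<longleftrightarrow> 0 \<le> l \<and> g 0 = x \<and> g l = y \<and> g ` {0..l} \<subseteq> M \<and>
     (\<forall>s\<in>{0..l}. \<forall>t\<in>{0..l}. d (g s) (g t) \<le> \<bar>s - t\<bar>)"

context length_graph
begin

lemma lipschitz_curve_join:
  assumes g: "lipschitz_curve (points G) (gdist G) x y l g"
    and h: "lipschitz_curve (points G) (gdist G) y z m h"
  shows "lipschitz_curve (points G) (gdist G) x z (l + m) (\<lambda>s. if s \<le> l then g s else h (s - l))"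
    (is "lipschitz_curve _ _ _ _ _ ?k")
proof -
  have gl: "0 \<le> l" "g 0 = x" "g l = y" "\<And>s. 0 \<le> s \<Longrightarrow> s \<le> l \<Longrightarrow> g s \<in> points G"
    "\<And>s t. 0 \<le> s \<Longrightarrow> s \<le> l \<Longrightarrow> 0 \<le> t \<Longrightarrow> t \<le> l \<Longrightarrow> gdist G (g s) (g t) \<le> \<bar>s - t\<bar>"
    using g by (auto simp: lipschitz_curve_def)
  have hm: "0 \<le> m" "h 0 = y" "h m = z" "\<And>s. 0 \<le> s \<Longrightarrow> s \<le> m \<Longrightarrow> h s \<in> points G"
    "\<And>s t. 0 \<le> s \<Longrightarrow> s \<le> m \<Longrightarrow> 0 \<le> t \<Longrightarrow> t \<le> m \<Longrightarrow> gdist G (h s) (h t) \<le> \<bar>s - t\<bar>"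
    using h by (auto simp: lipschitz_curve_def)
  have mem: "?k s \<in> points G" if "s \<in> {0..l + m}" for s
    using that gl(4) hm(4) by simp
  have lip: "gdist G (?k s) (?k t) \<le> t - s" if st: "0 \<le> s" "s \<le> t" "t \<le> l + m" for s t
  proof -
    consider "t \<le> l" | "s \<le> l" "l < t" | "l < s" using st by linarith
    then show ?thesis
    proof cases
      case 1
      then show ?thesis using gl(5)[of s t] st by simp
    next
      case 2
      have "gdist G (g s) (h (t - l)) \<le> gdist G (g s) y + gdist G y (h (t - l))"
        using gl(3,4) hm(4) st 2 gl(1) by (intro gdist_triangle) auto
      then show ?thesis using gl(5)[of s l] hm(5)[of 0 "t - l"] gl(1-3) hm(1-3) st 2 by simp
    next
      case 3
      then show ?thesis using hm(5)[of "s - l" "t - l"] st by simp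
    qed
  qed
  have "gdist G (?k s) (?k t) \<le> \<bar>s - t\<bar>" if "s \<in> {0..l + m}" "t \<in> {0..l + m}" for s t
    using lip[of s t] lip[of t s] that gdist_commute[OF mem[OF that(1)] mem[OF that(2)]]
    by (cases "s \<le> t") auto
  moreover have "?k 0 = x" "?k (l + m) = z"
    using gl(1-3) hm(1-3) by auto
  ultimately show ?thesis
    unfolding lipschitz_curve_def using mem add_nonneg_nonneg[OF gl(1) hm(1)] by blast
qed

lemma lipschitz_curve_path:
  "path_between G x \<sigma> y \<Longrightarrow> \<exists>g. lipschitz_curve (points G) (gdist G) x y (path_length \<sigma>) g"
proof (induction \<sigma> arbitrary: x)
  case Nil
  then have "lipschitz_curve (points G) (gdist G) x y 0 (\<lambda>_. x)"
    by (auto simp: lipschitz_curve_def)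
  then show ?case by auto
next
  case (Cons a \<sigma>)
  obtain e s t where a: "a = (e, s, t)" by (cases a)
  have e: "e \<in> edges G" "s \<in> {0..elen G e}" "t \<in> {0..elen G e}" "x = edge_point G e s"
    and tl: "path_between G (edge_point G e t) \<sigma> y"
    using Cons.prems a by auto
  \<comment> \<open>Arc-length parametrization in the direction of travel; for \<open>s = t\<close>
    it is constant on the single parameter 0.\<close>
  define g where "g r = edge_point G e (s + sgn (t - s) * r)" for r
  have r: "s + sgn (t - s) * r \<in> {0..elen G e}" if "r \<in> {0..\<bar>t - s\<bar>}" for r
    using that e by (auto simp: sgn_if split: if_splits)
  have "gdist G (g r) (g r') \<le> \<bar>r - r'\<bar>" if "r \<in> {0..\<bar>t - s\<bar>}" "r' \<in> {0..\<bar>t - s\<bar>}" for r r'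
    using gdist_edge_point[OF e(1) r[OF that(1)] r[OF that(2)]]
    unfolding g_def by (auto simp: sgn_if split: if_splits)
  moreover have "g r \<in> points G" if "r \<in> {0..\<bar>t - s\<bar>}" for r
    unfolding g_def using edge_point_in_points[OF e(1) r[OF that]] .
  moreover have "g 0 = x" "g \<bar>t - s\<bar> = edge_point G e t"
    using e(4) by (auto simp: g_def sgn_if)
  ultimately have "lipschitz_curve (points G) (gdist G) x (edge_point G e t) \<bar>t - s\<bar> g"
    by (auto simp: lipschitz_curve_def)
  then show ?case
    using Cons.IH[OF tl] lipschitz_curve_join unfolding a path_length_simps by blast
qed

text \<open>There is no slack: if \<open>g s\<close> and \<open>g t\<close> were closer than
  \<open>t - s\<close>, the Lipschitz bounds on the two remaining pieces would make the distance
  from \<open>x\<close> to \<open>y\<close> smaller than itself.\<close>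

lemma geodesic_lipschitz_curve:
  assumes g: "lipschitz_curve (points G) (gdist G) x y (gdist G x y) g"
  shows "geodesic (points G) (gdist G) x y (g ` {0..gdist G x y})"
proof -
  let ?l = "gdist G x y"
  have mem: "g s \<in> points G" if "s \<in> {0..?l}" for s
    using g that by (auto simp: lipschitz_curve_def)
  have lip: "gdist G (g s) (g t) \<le> \<bar>s - t\<bar>" if "s \<in> {0..?l}" "t \<in> {0..?l}" for s t
    using g that by (auto simp: lipschitz_curve_def)
  have l: "0 \<le> ?l" "g 0 = x" "g ?l = y" using g by (auto simp: lipschitz_curve_def)
  have ge: "t - s \<le> gdist G (g s) (g t)" if "s \<in> {0..?l}" "t \<in> {0..?l}" "s \<le> t" for s t
  proof -
    have "?l \<le> gdist G (g 0) (g s) + gdist G (g s) (g ?l)"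
      using gdist_triangle[OF mem[of 0] mem[of s] mem[of ?l]] l that by auto
    moreover have "gdist G (g s) (g ?l) \<le> gdist G (g s) (g t) + gdist G (g t) (g ?l)"
      using gdist_triangle[OF mem[of s] mem[of t] mem[of ?l]] l that by auto
    ultimately show ?thesis
      using lip[of 0 s] lip[of t ?l] l that by auto
  qed
  have "gdist G (g s) (g t) = \<bar>s - t\<bar>" if "s \<in> {0..?l}" "t \<in> {0..?l}" for s t
    using ge[of s t] ge[of t s] lip[of s t] that gdist_commute[OF mem[OF that(1)] mem[OF that(2)]]
    by (cases "s \<le> t") auto
  then show ?thesis
    unfolding geodesic_def using l mem by (intro exI[of _ g]) auto
qed

lemma geodesic_dist:
  assumes "geodesic (points G) (gdist G) x y S" "p \<in> S" "q \<in> S"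
  shows "gdist G p q = \<bar>gdist G x p - gdist G x q\<bar>"
proof -
  obtain g where g: "g 0 = x" "g ` {0..gdist G x y} = S"
    "\<forall>s\<in>{0..gdist G x y}. \<forall>t\<in>{0..gdist G x y}. gdist G (g s) (g t) = \<bar>s - t\<bar>"
    using assms(1) by (auto simp: geodesic_def)
  obtain s t where st: "s \<in> {0..gdist G x y}" "t \<in> {0..gdist G x y}" "p = g s" "q = g t"
    using assms(2,3) g(2) by blast
  have "gdist G (g 0) (g s) = \<bar>0 - s\<bar>" "gdist G (g 0) (g t) = \<bar>0 - t\<bar>"
    using g(3) st(1,2) by (metis atLeastAtMost_iff order_refl order_trans)+
  moreover have "gdist G (g s) (g t) = \<bar>s - t\<bar>" using g(3) st by blast
  ultimately show ?thesis using st g(1) by auto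
qed

lemma geodesic_rev:
  assumes "x \<in> points G" "y \<in> points G" "geodesic (points G) (gdist G) x y S"
  shows "geodesic (points G) (gdist G) y x S"
proof -
  define l where "l = gdist G x y"
  have l': "gdist G y x = l" using gdist_commute assms(1,2) by (simp add: l_def)
  obtain g where g: "g 0 = x" "g l = y" "g ` {0..l} = S" "S \<subseteq> points G"
    "\<forall>s\<in>{0..l}. \<forall>t\<in>{0..l}. gdist G (g s) (g t) = \<bar>s - t\<bar>"
    using assms(3) unfolding geodesic_def l_def by blast
  have "(\<lambda>s. g (l - s)) ` {0..l} = g ` ((\<lambda>s. l - s) ` {0..l})" by (simp only: image_image)
  also have "(\<lambda>s. l - s) ` {0..l} = {0..l}" by simp
  finally have "(\<lambda>s. g (l - s)) ` {0..l} = S" unfolding g(3) .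
  then show ?thesis
    unfolding geodesic_def l' using g by (intro exI[of _ "\<lambda>s. g (l - s)"]) auto
qed

end

section \<open>Bigons in hyperbolic geodesic graphs\<close>

locale geodesic_graph = length_graph +
  assumes shortest_path_exists:
    "x \<in> points G \<Longrightarrow> y \<in> points G \<Longrightarrow> \<exists>\<sigma>. path_between G x \<sigma> y \<and> path_length \<sigma> = gdist G x y"
begin

lemma geodesic_through:
  assumes "x \<in> points G" "m \<in> points G" "y \<in> points G"
    and "gdist G x m + gdist G m y = gdist G x y"
  obtains S where "geodesic (points G) (gdist G) x y S" "m \<in> S"
proof -
  obtain g h where gh: "lipschitz_curve (points G) (gdist G) x m (gdist G x m) g"
    "lipschitz_curve (points G) (gdist G) m y (gdist G m y) h"
    using shortest_path_exists lipschitz_curve_path assms(1,2,3) by metis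
  let ?k = "\<lambda>s. if s \<le> gdist G x m then g s else h (s - gdist G x m)"
  have "lipschitz_curve (points G) (gdist G) x y (gdist G x y) ?k"
    using lipschitz_curve_join[OF gh] assms(4) by simp
  from geodesic_lipschitz_curve[OF this] show ?thesis
  proof (rule that)
    have "m = ?k (gdist G x m)" using gh by (simp add: lipschitz_curve_def)
    moreover have "gdist G x m \<in> {0..gdist G x y}"
      using gdist_nonneg assms by (metis atLeastAtMost_iff le_add_same_cancel1)
    ultimately show "m \<in> ?k ` {0..gdist G x y}" by (rule image_eqI)
  qed
qed

text \<open>A bigon is a triangle with a constant third side at \<open>y\<close>. Thinness puts some
  \<open>p\<close> on the side through \<open>b\<close> within \<open>\<delta>\<close> of
  \<open>a\<close>. As \<open>a\<close> and \<open>b\<close> are equally far from \<open>x\<close>,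
  the positions of \<open>p\<close> and \<open>b\<close> along that side differ by at most the
  distance from \<open>a\<close> to \<open>p\<close>, which gives the second
  \<open>\<delta>\<close>.\<close>

lemma hyperbolic_bigon:
  assumes hyp: "hyperbolic (points G) (gdist G) \<delta>"
    and pts: "x \<in> points G" "y \<in> points G" "a \<in> points G" "b \<in> points G"
    and a: "gdist G x a + gdist G a y = gdist G x y"
    and b: "gdist G x b + gdist G b y = gdist G x y"
    and ab: "gdist G x a = gdist G x b"
  shows "gdist G a b \<le> 2 * \<delta>"
proof -
  obtain A where A: "geodesic (points G) (gdist G) x y A" "a \<in> A"
    using geodesic_through[OF pts(1,3,2) a] .
  obtain B where B: "geodesic (points G) (gdist G) x y B" "b \<in> B"
    using geodesic_through[OF pts(1,4,2) b] .
  have Y: "geodesic (points G) (gdist G) y y {y}"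
    using pts(2) by (auto simp: geodesic_def)
  have "thin_triangle (points G) (gdist G) \<delta> A {y} B"
    using hyp pts A(1) Y geodesic_rev[OF pts(1,2) B(1)] unfolding hyperbolic_def by blast
  then obtain p where p: "p \<in> {y} \<union> B" "gdist G a p \<le> \<delta>"
    using A(2) unfolding thin_triangle_def neighborhood_def by blast
  obtain g where "g (gdist G x y) = y" "g ` {0..gdist G x y} = B" "B \<subseteq> points G"
    using B(1) unfolding geodesic_def by blast
  \<comment> \<open>The constant side is contained in \<open>B\<close>, so \<open>p\<close> lies on
    \<open>B\<close> in either case.\<close>
  then have "y \<in> B" using gdist_nonneg[OF pts(1,2)] by (metis atLeastAtMost_iff image_eqI order_refl)
  then have pB: "p \<in> B" "p \<in> points G" using p(1) \<open>B \<subseteq> points G\<close> by auto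
  have "gdist G p b = \<bar>gdist G x p - gdist G x b\<bar>" using geodesic_dist[OF B(1) pB(1) B(2)] .
  also have "\<dots> \<le> gdist G a p"
    using gdist_triangle[OF pts(1,3) pB(2)] gdist_triangle[OF pts(1) pB(2) pts(3)]
      gdist_commute[OF pts(3) pB(2)] ab by simp
  finally show ?thesis
    using p(2) gdist_triangle[OF pts(3) pB(2) pts(4)] by simp
qed

end

section \<open>The length metric of a cycle\<close>

locale graph_cycle = incidence_graph +
  fixes c :: "('b \<times> bool) list"
  assumes cycle: "is_cycle G c"
begin

abbreviation "C \<equiv> cycle_graph G c"
abbreviation "L \<equiv> cycle_length G c"

section \<open>Arc-length parametrization of a cycle\<close>

definition step_length :: "nat \<Rightarrow> real" where
  "step_length i = elen G (fst (c ! i))"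

definition corner :: "nat \<Rightarrow> real" where
  "corner i = (\<Sum>j<i. step_length j)"

text \<open>Here \<open>\<tau>\<close> is arc length from the start of the step, so the edge
  parameter runs backwards on an edge traversed from head to tail.\<close>

definition step_point :: "nat \<Rightarrow> real \<Rightarrow> ('a, 'b) point" where
  "step_point i \<tau> =
     edge_point G (fst (c ! i)) (if snd (c ! i) then \<tau> else step_length i - \<tau>)"

text \<open>The \<open>L\<close>-periodic arc-length parametrization of the cycle.\<close>

definition loop :: "real \<Rightarrow> ('a, 'b) point" where
  "loop u =
     (let w = u - L * of_int \<lfloor>u / L\<rfloor>; i = (THE i. i < length c \<and> corner i \<le> w \<and> w < corner (Suc i))
      in step_point i (w - corner i))"

lemma edge_in: "i < length c \<Longrightarrow> fst (c ! i) \<in> edges G"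
  using cycle by (auto simp: is_cycle_def)

lemma step_length_pos: "i < length c \<Longrightarrow> 0 < step_length i"
  using edge_in incidence by (auto simp: step_length_def)

lemma corner_Suc: "corner (Suc i) = corner i + step_length i"
  by (simp add: corner_def)

lemma corner_0 [simp]: "corner 0 = 0"
  by (simp add: corner_def)

lemma corner_mono: "i \<le> j \<Longrightarrow> j \<le> length c \<Longrightarrow> corner i \<le> corner j"
  unfolding corner_def by (intro sum_mono2) (auto intro!: less_imp_le step_length_pos)

lemma corner_length: "corner (length c) = L"
  by (auto simp: corner_def cycle_length_def step_length_def sum_list_sum_nth case_prod_beta
      lessThan_atLeast0 intro!: sum.cong)

lemma cycle_length_pos: "0 < L"
proof -
  have "0 < length c" using cycle by (auto simp: is_cycle_def)
  then have "corner (Suc 0) \<le> L" using corner_mono[of "Suc 0" "length c"] by (simp add: corner_length Suc_le_eq)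
  then show ?thesis using step_length_pos[OF \<open>0 < length c\<close>] by (simp add: corner_Suc)
qed

lemma step_point_0: "i < length c \<Longrightarrow> step_point i 0 = Vertex (step_start G (c ! i))"
  using step_length_pos[of i]
  by (auto simp: step_point_def edge_point_def step_start_def step_length_def case_prod_beta)

lemma step_point_end: "i < length c \<Longrightarrow> step_point i (step_length i) = Vertex (step_end G (c ! i))"
  using step_length_pos[of i]
  by (auto simp: step_point_def edge_point_def step_end_def step_length_def case_prod_beta)

lemma step_point_inner:
  "0 < \<tau> \<Longrightarrow> \<tau> < step_length i \<Longrightarrow>
    step_point i \<tau> = Inner (fst (c ! i)) (if snd (c ! i) then \<tau> else step_length i - \<tau>)"
  by (auto simp: step_point_def edge_point_def step_length_def)

lemma step_point_next:
  assumes "i < length c"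
  shows "step_point i (step_length i) = step_point (Suc i mod length c) 0"
  using assms cycle step_point_0[of "Suc i mod length c"] step_point_end[OF assms]
  by (auto simp: is_cycle_def)

text \<open>The half-open ranges represent a vertex only as the start of a step. Vertices are told
  apart by distinctness of the starts, interior points by distinctness of the edges.\<close>

lemma step_point_inj:
  assumes "i < length c" "j < length c"
    and "0 \<le> \<tau>" "\<tau> < step_length i" "0 \<le> \<tau>'" "\<tau>' < step_length j"
    and eq: "step_point i \<tau> = step_point j \<tau>'"
  shows "i = j \<and> \<tau> = \<tau>'"
proof -
  have d: "distinct (map (step_start G) c)" "distinct (map fst c)"
    using cycle by (auto simp: is_cycle_def)
  show ?thesis
  proof (cases "\<tau> = 0")
    case True
    then have "\<tau>' = 0"
      using eq step_point_0[OF assms(1)] step_point_inner[of \<tau>' j] assms by force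
    with True show ?thesis
      using eq step_point_0[OF assms(1)] step_point_0[OF assms(2)] d(1) assms(1,2)
      by (simp add: distinct_conv_nth) metis
  next
    case False
    then have "\<tau>' \<noteq> 0"
      using eq step_point_0[OF assms(2)] step_point_inner[of \<tau> i] assms by force
    then have *: "fst (c ! i) = fst (c ! j)"
      "(if snd (c ! i) then \<tau> else step_length i - \<tau>) =
       (if snd (c ! j) then \<tau>' else step_length j - \<tau>')"
      using False eq step_point_inner[of \<tau> i] step_point_inner[of \<tau>' j] assms by auto
    then have "i = j" using d(2) assms(1,2) by (simp add: distinct_conv_nth) metis
    with * show ?thesis by (auto split: if_splits)
  qed
qed

lemma corner_cell: "0 \<le> w \<Longrightarrow> w < corner m \<Longrightarrow> \<exists>i<m. corner i \<le> w \<and> w < corner (Suc i)"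
proof (induction m)
  case (Suc m)
  then show ?case by (cases "w < corner m") (auto simp: less_Suc_eq)
qed simp

lemma corner_cell_left: "0 < w \<Longrightarrow> w \<le> corner m \<Longrightarrow> \<exists>i<m. corner i < w \<and> w \<le> corner (Suc i)"
proof (induction m)
  case (Suc m)
  then show ?case by (cases "w \<le> corner m") (auto simp: less_Suc_eq)
qed simp

lemma corner_cell_unique:
  assumes "i < length c" "j < length c"
    and "corner i \<le> w" "w < corner (Suc i)" "corner j \<le> w" "w < corner (Suc j)"
  shows "i = j"
  using assms corner_mono[of "Suc i" j] corner_mono[of "Suc j" i]
  by (cases i j rule: linorder_cases) auto

lemma real_cell:
  obtains i \<tau> k where "i < length c" "0 \<le> \<tau>" "\<tau> < step_length i"
    "u = L * of_int k + corner i + \<tau>"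
proof -
  define w where "w = u - L * of_int \<lfloor>u / L\<rfloor>"
  have "0 \<le> w" "w < L"
    using cycle_length_pos floor_divide_lower[of L u] floor_divide_upper[of L u]
    by (auto simp: w_def algebra_simps)
  then obtain i where "i < length c" "corner i \<le> w" "w < corner (Suc i)"
    using corner_cell[of w "length c"] by (auto simp: corner_length)
  then show ?thesis
    by (intro that[of i "w - corner i" "\<lfloor>u / L\<rfloor>"]) (simp_all add: w_def corner_Suc)
qed

text \<open>At a vertex this yields the step that ends there, whereas \<open>real_cell\<close>
  yields the one that starts there. Together they describe a two-sided neighborhood of any
  position.\<close>

lemma real_cell_left:
  obtains i \<tau> k where "i < length c" "0 < \<tau>" "\<tau> \<le> step_length i"
    "u = L * of_int k + corner i + \<tau>"
proof -
  \<comment> \<open>This \<open>k\<close> leaves a remainder in (0, L] instead of [0, L).\<close>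
  define k where "k = \<lceil>u / L\<rceil> - 1"
  define w where "w = u - L * of_int k"
  have "0 < w" "w \<le> L"
    using cycle_length_pos ceiling_divide_lower[of L u] ceiling_divide_upper[of L u]
    by (auto simp: w_def k_def algebra_simps)
  then obtain i where "i < length c" "corner i < w" "w \<le> corner (Suc i)"
    using corner_cell_left[of w "length c"] by (auto simp: corner_length)
  then show ?thesis
    by (intro that[of i "w - corner i" k]) (simp_all add: w_def corner_Suc)
qed

text \<open>The right end of a step belongs to the next cell, or to the next period after the last
  step; the values agree because consecutive steps share a vertex.\<close>

lemma loop_cell:
  assumes i: "i < length c" and \<tau>: "0 \<le> \<tau>" "\<tau> \<le> step_length i"
  shows "loop (L * of_int k + corner i + \<tau>) = step_point i \<tau>"
proof -
  have *: "loop (L * of_int k + corner i + \<tau>) = step_point i \<tau>"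
    if i: "i < length c" and \<tau>: "0 \<le> \<tau>" "\<tau> < step_length i" for i \<tau> and k :: int
  proof -
    have "0 \<le> corner i" "corner (Suc i) \<le> L"
      using i corner_mono[of 0 i] corner_mono[of "Suc i" "length c"] by (auto simp: corner_length)
    then have "0 \<le> corner i + \<tau>" "corner i + \<tau> < L" using \<tau> by (auto simp: corner_Suc)
    then have "\<lfloor>(L * of_int k + corner i + \<tau>) / L\<rfloor> = k"
      using cycle_length_pos by (intro floor_unique) (auto simp: field_simps)
    moreover have "(THE j. j < length c \<and> corner j \<le> corner i + \<tau> \<and> corner i + \<tau> < corner (Suc j)) = i"
      using i \<tau> by (intro the_equality) (auto simp: corner_Suc intro: corner_cell_unique[of _ _ "corner i + \<tau>"])
    ultimately show ?thesis by (simp add: loop_def Let_def)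
  qed
  show ?thesis
  proof (cases "\<tau> < step_length i")
    case True
    then show ?thesis using * i \<tau> by blast
  next
    case False
    then have \<tau>_eq: "\<tau> = step_length i" using \<tau> by simp
    show ?thesis
    proof (cases "Suc i = length c")
      case True
      then have "0 < length c" by linarith
      have "L * of_int k + corner i + \<tau> = L * of_int (k + 1) + corner 0 + 0"
        using True corner_length corner_Suc[of i] \<tau>_eq by (simp add: algebra_simps)
      then show ?thesis
        using *[OF \<open>0 < length c\<close>, of 0 "k + 1"] step_length_pos[OF \<open>0 < length c\<close>] step_point_next[OF i] True \<tau>_eq
        by (metis mod_self order_refl)
    next
      case False
      then have S: "Suc i < length c" using i by simp
      have "L * of_int k + corner i + \<tau> = L * of_int k + corner (Suc i) + 0"
        using corner_Suc[of i] \<tau>_eq by simp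
      then show ?thesis
        using *[OF S, of 0 k] step_length_pos[OF S] step_point_next[OF i] S \<tau>_eq by (metis mod_less order_refl)
    qed
  qed
qed

lemma loop_periodic: "loop (u + L * of_int m) = loop u"
proof -
  obtain i \<tau> k where u: "i < length c" "0 \<le> \<tau>" "\<tau> < step_length i"
    "u = L * of_int k + corner i + \<tau>" by (rule real_cell)
  have "u + L * of_int m = L * of_int (k + m) + corner i + \<tau>"
    by (simp add: u(4) algebra_simps)
  then show ?thesis using loop_cell[OF u(1,2) less_imp_le[OF u(3)]] u(4) by metis
qed

lemma loop_eqD:
  assumes "loop u = loop u'"
  obtains k :: int where "u = u' + L * of_int k"
proof -
  obtain i \<tau> k where u: "i < length c" "0 \<le> \<tau>" "\<tau> < step_length i"
    "u = L * of_int k + corner i + \<tau>" by (rule real_cell)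
  obtain i' \<tau>' k' where u': "i' < length c" "0 \<le> \<tau>'" "\<tau>' < step_length i'"
    "u' = L * of_int k' + corner i' + \<tau>'" by (rule real_cell)
  have "step_point i \<tau> = step_point i' \<tau>'"
    using assms loop_cell[OF u(1,2)] loop_cell[OF u'(1,2)] u(3,4) u'(3,4) by auto
  then have "i = i' \<and> \<tau> = \<tau>'" using step_point_inj u u' by blast
  then show ?thesis using that[of "k - k'"] u u' by (simp add: algebra_simps)
qed

section \<open>The cycle as a metric graph of its own\<close>

lemma cycle_graph_simps [simp]:
  "edges C = fst ` set c" "verts C = step_start G ` set c" "elen C = elen G"
  "tail C = tail G" "head C = head G" "edge_point C = edge_point G"
  by (auto simp: cycle_graph_def edge_point_def fun_eq_iff)

lemma step_end_in: "i < length c \<Longrightarrow> step_end G (c ! i) \<in> step_start G ` set c"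
proof -
  assume i: "i < length c"
  then have "step_end G (c ! i) = step_start G (c ! (Suc i mod length c))"
    using cycle by (auto simp: is_cycle_def)
  moreover have "Suc i mod length c < length c" using i by (intro mod_less_divisor) linarith
  ultimately show ?thesis by simp
qed

sublocale cyc: incidence_graph C
proof
  fix e assume "e \<in> edges C"
  then obtain i where i: "i < length c" "e = fst (c ! i)" by (auto simp: in_set_conv_nth)
  have "step_start G (c ! i) \<in> step_start G ` set c" using i by simp
  then have "tail G e \<in> step_start G ` set c \<and> head G e \<in> step_start G ` set c"
    using step_end_in[OF i(1)] i(2)
    by (cases "snd (c ! i)") (simp_all add: step_start_def step_end_def case_prod_beta)
  then show "tail C e \<in> verts C \<and> head C e \<in> verts C \<and> 0 < elen C e"
    using edge_in[OF i(1)] incidence i(2) by simp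
qed

lemma cycle_points_subset: "points C \<subseteq> points G"
proof -
  have "step_start G ` set c \<subseteq> verts G"
    using cycle incidence unfolding is_cycle_def step_start_def by fastforce
  moreover have "fst ` set c \<subseteq> edges G" using cycle by (simp add: is_cycle_def)
  ultimately show ?thesis by (auto simp: points_def)
qed

lemma path_between_cycle: "path_between C x \<sigma> y \<Longrightarrow> path_between G x \<sigma> y"
proof (induction \<sigma> arbitrary: x)
  case Nil
  then show ?case using cycle_points_subset by auto
next
  case (Cons a \<sigma>)
  moreover have "fst ` set c \<subseteq> edges G" using cycle by (simp add: is_cycle_def)
  ultimately show ?case by (cases a) auto
qed

lemma step_point_path:
  assumes i: "i < length c" and \<tau>: "0 \<le> \<tau>" "\<tau> \<le> step_length i" "0 \<le> \<tau>'" "\<tau>' \<le> step_length i"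
  shows "\<exists>\<sigma>. path_between C (step_point i \<tau>) \<sigma> (step_point i \<tau>') \<and> path_length \<sigma> = \<bar>\<tau>' - \<tau>\<bar>"
proof -
  let ?e = "fst (c ! i)" and ?f = "\<lambda>\<tau>. if snd (c ! i) then \<tau> else step_length i - \<tau>"
  have "path_between C (edge_point C ?e (?f \<tau>)) [(?e, ?f \<tau>, ?f \<tau>')] (edge_point C ?e (?f \<tau>'))"
    using i \<tau> by (intro cyc.path_between_segment) (auto simp: step_length_def)
  moreover have "path_length [(?e, ?f \<tau>, ?f \<tau>')] = \<bar>\<tau>' - \<tau>\<bar>" by auto
  ultimately show ?thesis unfolding step_point_def cycle_graph_simps by blast
qed

text \<open>The claim passes from adjacent intervals to their union, so by Bolzano's bisection
  principle it suffices to check short intervals around each point.\<close>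

lemma loop_path:
  assumes "u \<le> v"
  shows "\<exists>\<sigma>. path_between C (loop u) \<sigma> (loop v) \<and> path_length \<sigma> = v - u"
proof (rule Bolzano[OF assms, where P = "\<lambda>u v. \<exists>\<sigma>. path_between C (loop u) \<sigma> (loop v) \<and> path_length \<sigma> = v - u"])
  fix p q r assume "\<exists>\<sigma>. path_between C (loop p) \<sigma> (loop q) \<and> path_length \<sigma> = q - p"
    "\<exists>\<sigma>. path_between C (loop q) \<sigma> (loop r) \<and> path_length \<sigma> = r - q"
  then obtain \<sigma> \<tau> where "path_between C (loop p) \<sigma> (loop q)" "path_length \<sigma> = q - p"
    "path_between C (loop q) \<tau> (loop r)" "path_length \<tau> = r - q" by blast
  then show "\<exists>\<sigma>. path_between C (loop p) \<sigma> (loop r) \<and> path_length \<sigma> = r - p"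
    by (intro exI[of _ "\<sigma> @ \<tau>"]) (auto simp: cyc.path_between_append)
next
  fix x
  obtain i \<tau> k where x: "i < length c" "0 \<le> \<tau>" "\<tau> < step_length i"
    "x = L * of_int k + corner i + \<tau>" by (rule real_cell)
  obtain i' \<tau>' k' where x': "i' < length c" "0 < \<tau>'" "\<tau>' \<le> step_length i'"
    "x = L * of_int k' + corner i' + \<tau>'" by (rule real_cell_left)
  \<comment> \<open>The room to the right of \<open>x\<close> in the step starting or running there,
    and to its left in the step ending or running there.\<close>
  define d where "d = min (step_length i - \<tau>) \<tau>'"
  have "\<exists>\<sigma>. path_between C (loop p) \<sigma> (loop q) \<and> path_length \<sigma> = q - p"
    if pq: "p \<le> x" "x \<le> q" "q - p < d" for p q
  proof -
    have q: "loop q = step_point i (\<tau> + (q - x))"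
      using loop_cell[OF x(1), of "\<tau> + (q - x)" k] x pq by (simp add: d_def)
    have p: "loop p = step_point i' (\<tau>' - (x - p))"
      using loop_cell[OF x'(1), of "\<tau>' - (x - p)" k'] x' pq by (simp add: d_def)
    have "loop x = step_point i \<tau>" "loop x = step_point i' \<tau>'"
      using loop_cell[OF x(1,2), of k] loop_cell[OF x'(1) less_imp_le[OF x'(2)], of k'] x x' by simp_all
    then obtain \<sigma> \<sigma>' where "path_between C (loop p) \<sigma> (loop x)" "path_length \<sigma> = x - p"
      "path_between C (loop x) \<sigma>' (loop q)" "path_length \<sigma>' = q - x"
      using step_point_path[OF x(1,2), of "\<tau> + (q - x)"] step_point_path[OF x'(1), of "\<tau>' - (x - p)" \<tau>']
        x x' pq p q by (auto simp: d_def)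
    then show ?thesis by (intro exI[of _ "\<sigma> @ \<sigma>'"]) (auto simp: cyc.path_between_append)
  qed
  moreover have "0 < d" using x(3) x'(2) by (simp add: d_def)
  ultimately show "\<exists>d>0. \<forall>p q. p \<le> x \<and> x \<le> q \<and> q - p < d \<longrightarrow>
      (\<exists>\<sigma>. path_between C (loop p) \<sigma> (loop q) \<and> path_length \<sigma> = q - p)" by blast
qed

text \<open>Each edge of the cycle is a unit-speed piece of \<open>loop\<close>; the sign
  \<open>s\<close> accounts for edges traversed against their parametrization.\<close>

lemma edge_point_loop:
  assumes "e \<in> edges C"
  obtains p s where "\<bar>s\<bar> = 1" "\<And>r. r \<in> {0..elen G e} \<Longrightarrow> edge_point G e r = loop (p + s * r)"
proof -
  obtain i where i: "i < length c" "e = fst (c ! i)" using assms by (auto simp: in_set_conv_nth)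
  show ?thesis
  proof (cases "snd (c ! i)")
    case True
    show ?thesis
      by (rule that[of 1 "corner i"]) (use True i loop_cell[OF i(1), of _ 0] in \<open>auto simp: step_point_def step_length_def\<close>)
  next
    case False
    show ?thesis
      by (rule that[of "-1" "corner i + step_length i"])
        (use False i loop_cell[OF i(1), of "step_length i - _" 0]
         in \<open>auto simp: step_point_def step_length_def add_diff_eq\<close>)
  qed
qed

lemma loop_surj:
  assumes "x \<in> points C"
  obtains u where "x = loop u"
proof (cases x)
  case (Vertex v)
  then obtain i where i: "i < length c" "v = step_start G (c ! i)"
    using assms by (auto simp: points_def in_set_conv_nth)
  then have "x = step_point i 0" using step_point_0 Vertex by simp
  then show ?thesis using that[of "corner i"] loop_cell[OF i(1), of 0 0] step_length_pos[OF i(1)] by simp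
next
  case (Inner e t)
  then have e: "e \<in> edges C" "0 < t" "t < elen G e" using assms by (auto simp: points_def)
  then obtain p s where "\<And>r. r \<in> {0..elen G e} \<Longrightarrow> edge_point G e r = loop (p + s * r)"
    using edge_point_loop by metis
  from this[of t] show ?thesis using that e Inner by (simp add: edge_point_def)
qed

lemma loop_in_points: "loop u \<in> points C"
  using loop_path[of u u] cyc.path_between_endpoints by blast

sublocale cyc: length_graph C
proof
  show "connected_graph C" unfolding connected_graph_def
  proof (intro ballI)
    fix x y assume "x \<in> points C" "y \<in> points C"
    then obtain u v where uv: "x = loop u" "y = loop v" by (meson loop_surj)
    show "\<exists>\<sigma>. path_between C x \<sigma> y"
      using loop_path[of u v] loop_path[of v u] cyc.path_between_rev unfolding uv
      by (meson linear)
  qed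
qed

section \<open>The cycle metric as the metric of the line modulo \<open>L\<close>\<close>

lemma cycle_dist_le: "gdist C (loop u) (loop v) \<le> \<bar>u - v\<bar>"
proof -
  have "gdist C (loop u) (loop v) \<le> v - u" if "u \<le> v" for u v
    using loop_path[OF that] gdist_le_path_length by metis
  from this[of u v] this[of v u] show ?thesis
    using cyc.gdist_commute[OF loop_in_points loop_in_points, of u v] by (cases "u \<le> v") auto
qed

text \<open>The line covers the cycle through \<open>loop\<close>. Lifted segment by segment, a path
  moves the lift on each segment by exactly the length of that segment.\<close>

lemma path_lift:
  "path_between C (loop u) \<sigma> y \<Longrightarrow> \<exists>v. y = loop v \<and> \<bar>u - v\<bar> \<le> path_length \<sigma>"
proof (induction \<sigma> arbitrary: u)
  case Nil
  then show ?case by auto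
next
  case (Cons a \<sigma>)
  obtain e r r' where a: "a = (e, r, r')" by (cases a)
  have e: "e \<in> edges C" "r \<in> {0..elen G e}" "r' \<in> {0..elen G e}" "loop u = edge_point G e r"
    and tl: "path_between C (edge_point G e r') \<sigma> y"
    using Cons.prems a by auto
  obtain p s where ps: "\<bar>s\<bar> = 1" "\<And>r. r \<in> {0..elen G e} \<Longrightarrow> edge_point G e r = loop (p + s * r)"
    using edge_point_loop[OF e(1)] by blast
  have "loop u = loop (p + s * r)" using e ps by simp
  then obtain k where k: "u = p + s * r + L * of_int k" by (rule loop_eqD)
  \<comment> \<open>The translate that matches the start of the segment is kept for its end.\<close>
  define u' where "u' = p + s * r' + L * of_int k"
  have "edge_point G e r' = loop u'" using e ps by (simp add: u'_def loop_periodic)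
  then obtain v where v: "y = loop v" "\<bar>u' - v\<bar> \<le> path_length \<sigma>" using Cons.IH tl by metis
  have "u' - u = s * (r' - r)" by (simp add: k u'_def algebra_simps)
  then have "\<bar>u' - u\<bar> = \<bar>r' - r\<bar>" using ps(1) by (simp add: abs_mult)
  then show ?case using v a by (intro exI[of _ v]) auto
qed

text \<open>A lifted path ends at some translate of \<open>v\<close> by a multiple of
  \<open>L\<close>, and rounding finds the translate nearest to \<open>u\<close>.\<close>

lemma cycle_dist_attained:
  obtains k :: int where "gdist C (loop u) (loop v) = \<bar>u - v - L * of_int k\<bar>"
proof -
  define k where "k = round ((u - v) / L)"
  have min: "\<bar>u - v - L * of_int k\<bar> \<le> \<bar>u - v - L * of_int m\<bar>" for m
  proof -
    have "\<bar>(u - v) / L - of_int k\<bar> \<le> \<bar>(u - v) / L - of_int m\<bar>"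
      unfolding k_def by (rule round_diff_minimal)
    then have "L * \<bar>(u - v) / L - of_int k\<bar> \<le> L * \<bar>(u - v) / L - of_int m\<bar>"
      using cycle_length_pos by simp
    moreover have "L * \<bar>(u - v) / L - of_int m\<bar> = \<bar>u - v - L * of_int m\<bar>" for m
    proof -
      have "L * \<bar>(u - v) / L - of_int m\<bar> = \<bar>L * ((u - v) / L - of_int m)\<bar>"
        using cycle_length_pos by (simp add: abs_mult)
      also have "L * ((u - v) / L - of_int m) = u - v - L * of_int m"
        using cycle_length_pos by (simp add: field_simps)
      finally show ?thesis .
    qed
    ultimately show ?thesis by simp
  qed
  have "\<bar>u - v - L * of_int k\<bar> \<le> gdist C (loop u) (loop v)"
  proof (rule cyc.le_gdist[OF loop_in_points loop_in_points])
    fix \<sigma> assume "path_between C (loop u) \<sigma> (loop v)"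
    then obtain v' where v': "loop v = loop v'" "\<bar>u - v'\<bar> \<le> path_length \<sigma>" using path_lift by blast
    obtain m where "v' = v + L * of_int m" using v'(1) by (metis loop_eqD)
    then have "\<bar>u - v - L * of_int m\<bar> \<le> path_length \<sigma>" using v'(2) by (simp add: algebra_simps)
    then show "\<bar>u - v - L * of_int k\<bar> \<le> path_length \<sigma>" using min[of m] by linarith
  qed
  moreover have "gdist C (loop u) (loop v) \<le> \<bar>u - v - L * of_int k\<bar>"
    using cycle_dist_le[of u "v + L * of_int k"] by (simp add: loop_periodic diff_diff_eq)
  ultimately show ?thesis using that by (meson order_antisym)
qed

lemma cycle_dist_ge:
  assumes "t \<le> \<bar>u - v\<bar>" "\<bar>u - v\<bar> \<le> L - t"
  shows "t \<le> gdist C (loop u) (loop v)"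
proof -
  obtain k where k: "gdist C (loop u) (loop v) = \<bar>u - v - L * of_int k\<bar>" by (rule cycle_dist_attained)
  have "t \<le> \<bar>u - v - L * of_int k\<bar>"
  proof (cases "k = 0")
    case False
    then have "1 \<le> \<bar>real_of_int k\<bar>" by linarith
    then have "L \<le> \<bar>L * of_int k\<bar>" using cycle_length_pos by (simp add: abs_mult)
    then show ?thesis using assms(2) by linarith
  qed (use assms in simp)
  then show ?thesis using k by simp
qed

text \<open>On an edge outside the cycle only the parameters 0 and \<open>elen G e\<close> can give
  points of the cycle, and a segment containing one of them has it as an end.\<close>

lemma off_cycle_trace:
  assumes "e \<in> edges G" "s \<in> {0..elen G e}" "t \<in> {0..elen G e}" "e \<notin> edges C"
  shows "edge_point G e ` {min s t..max s t} \<inter> points C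
    = {edge_point G e s, edge_point G e t} \<inter> points C"
proof -
  have "r = s \<or> r = t" if "r \<in> {min s t..max s t}" "edge_point G e r \<in> points C" for r
    using that assms by (auto simp: points_def edge_point_def min_def max_def split: if_splits)
  then show ?thesis by fastforce
qed

lemma gdist_le_cycle_dist:
  assumes "x \<in> points C" "y \<in> points C"
  shows "gdist G x y \<le> gdist C x y"
  using assms by (rule cyc.le_gdist) (metis gdist_le_path_length path_between_cycle)

end

section \<open>Points far from all strict shortcuts\<close>

locale geodesic_graph_cycle = geodesic_graph + graph_cycle
begin

text \<open>Only the first vertex is tested, because excursions are followed from the vertex where
  they leave the cycle.\<close>

definition shortcut_free :: "('a, 'b) point \<Rightarrow> real \<Rightarrow> bool" where
  "shortcut_free x \<rho> \<longleftrightarrow> (\<forall>p \<tau> q. strict_shortcut G c p \<tau> q \<longrightarrow> \<rho> \<le> gdist C x (Vertex p))"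

text \<open>
  An excursion of a path away from the cycle that starts within distance \<open>\<rho>\<close> of \<open>x\<close> is not a
  strict shortcut, so replacing it by an arc of the cycle does not increase the length. Hence the
  path cannot beat the cycle metric before it has reached distance \<open>\<rho>\<close>. The third alternative
  describes a path that is currently on such an excursion, which started at \<open>p\<close>.
\<close>

lemma path_far_from_shortcuts:
  assumes x: "x \<in> points C"
    and free: "shortcut_free x \<rho>"
    and "path_between G x \<sigma> z"
  shows "(\<exists>v\<in>points C. \<rho> \<le> gdist C x v \<and> gdist C x v + gdist G v z \<le> path_length \<sigma>) \<or>
    (z \<in> points C \<and> gdist C x z \<le> path_length \<sigma>) \<or>
    (z \<notin> points C \<and> (\<exists>p \<tau>. p \<in> verts C \<and> gdist C x (Vertex p) < \<rho> \<and>
       path_between G (Vertex p) \<tau> z \<and> path_trace G (Vertex p) \<tau> \<inter> points C = {Vertex p} \<and>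
       gdist C x (Vertex p) + path_length \<tau> \<le> path_length \<sigma>))"
  using assms(3)
\<comment> \<open>Segments are appended at the end, so the three alternatives are an invariant of
  the growing path.\<close>
proof (induction \<sigma> arbitrary: z rule: rev_induct)
  case Nil
  then show ?case using x by auto
next
  case (snoc seg \<sigma>)
  obtain e s t where seg: "seg = (e, s, t)" by (cases seg)
  obtain y where \<sigma>: "path_between G x \<sigma> y" and "path_between G y [(e, s, t)] z"
    using snoc.prems by (auto simp: path_between_append seg)
  then have e: "e \<in> edges G" "s \<in> {0..elen G e}" "t \<in> {0..elen G e}"
    and y: "y = edge_point G e s" and z: "z = edge_point G e t" by auto
  have len: "path_length (\<sigma> @ [seg]) = path_length \<sigma> + \<bar>t - s\<bar>" by (simp add: seg)
  have yz: "y \<in> points G" "z \<in> points G" using y z e edge_point_in_points by auto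
  have Vertex_in: "Vertex p \<in> points C" if "p \<in> verts C" for p
    using that by (auto simp: points_def)
  \<comment> \<open>A current point on the cycle at distance at least \<open>\<rho>\<close> serves
    itself as \<open>v\<close>; hence the strict bound in the second case.\<close>
  consider (far) v where "v \<in> points C" "\<rho> \<le> gdist C x v" "gdist C x v + gdist G v y \<le> path_length \<sigma>"
    | (on) "y \<in> points C" "gdist C x y < \<rho>" "gdist C x y \<le> path_length \<sigma>"
    | (off) p \<tau> where "y \<notin> points C" "p \<in> verts C" "gdist C x (Vertex p) < \<rho>"
       "path_between G (Vertex p) \<tau> y" "path_trace G (Vertex p) \<tau> \<inter> points C = {Vertex p}"
       "gdist C x (Vertex p) + path_length \<tau> \<le> path_length \<sigma>"
    using snoc.IH[OF \<sigma>] gdist_self[OF yz(1)] by (metis add.right_neutral not_less)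
  then show ?case
  proof cases
    case far
    have "v \<in> points G" using far(1) cycle_points_subset by blast
    then have "gdist G v z \<le> gdist G v y + \<bar>t - s\<bar>"
      using gdist_triangle[of v y z] yz gdist_edge_point[OF e] y z by fastforce
    then show ?thesis using far len by (intro disjI1 bexI[of _ v]) auto
  next
    case on
    show ?thesis
    proof (cases "e \<in> edges C")
      case True
      have zC: "z \<in> points C" using cyc.edge_point_in_points[OF True, of t] z e by simp
      have "gdist C y z \<le> \<bar>t - s\<bar>" using cyc.gdist_edge_point[OF True, of s t] y z e by simp
      then show ?thesis using cyc.gdist_triangle[OF x on(1) zC] on(3) zC len by auto
    next
      case False
      \<comment> \<open>A segment off the cycle can leave it only at a vertex.\<close>
      obtain p where p: "p \<in> verts C" "y = Vertex p"
        using on(1) False y by (auto simp: points_def edge_point_def split: if_splits)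
      have tr: "path_trace G y [seg] \<inter> points C = {y, z} \<inter> points C"
        using y z off_cycle_trace[OF e False] by (auto simp: path_trace_def seg)
      have seg_path: "path_between G (Vertex p) [seg] z"
        using path_between_segment[OF e] y z p seg by simp
      show ?thesis
      proof (cases "z \<in> points C")
        case True
        obtain q where q: "q \<in> verts C" "z = Vertex q"
          using True False z by (auto simp: points_def edge_point_def split: if_splits)
        \<comment> \<open>The segment is a complete excursion starting within \<open>\<rho>\<close>
          of \<open>x\<close>, so it is no shorter than the cycle distance of its ends.\<close>
        have "\<not> strict_shortcut G c p [seg] q" using free on(2) p(2) unfolding shortcut_free_def by (metis not_le)
        then have "gdist C y z \<le> \<bar>t - s\<bar>"
          using seg_path tr p q on(1) True by (auto simp: strict_shortcut_def shortcut_def seg)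
        then show ?thesis using cyc.gdist_triangle[OF x on(1) True] on(3) True len by auto
      next
        case False
        have "path_trace G (Vertex p) [seg] \<inter> points C = {Vertex p}"
          using tr p(2) on(1) False by auto
        then show ?thesis
          using False p seg_path on len by (intro disjI2 conjI exI[of _ p] exI[of _ "[seg]"]) (auto simp: seg)
      qed
    qed
  next
    case off
    have eC: "e \<notin> edges C"
      using off(1) cyc.edge_point_in_points[of e s] y e by auto
    have tr: "path_trace G (Vertex p) (\<tau> @ [seg]) \<inter> points C = {Vertex p} \<union> ({z} \<inter> points C)"
    proof -
      have "path_trace G (Vertex p) (\<tau> @ [seg]) =
          path_trace G (Vertex p) \<tau> \<union> edge_point G e ` {min s t..max s t}"
        by (auto simp: path_trace_def seg)
      then show ?thesis using off_cycle_trace[OF e eC] y z off(1,5) by auto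
    qed
    have path: "path_between G (Vertex p) (\<tau> @ [seg]) z"
      using off(4) path_between_segment[OF e] y z seg by (auto simp: path_between_append)
    show ?thesis
    proof (cases "z \<in> points C")
      case True
      obtain q where q: "q \<in> verts C" "z = Vertex q"
        using True eC z by (auto simp: points_def edge_point_def split: if_splits)
      \<comment> \<open>The excursion begun at \<open>p\<close> returns to the cycle here and can be
        replaced by an arc.\<close>
      have "\<not> strict_shortcut G c p (\<tau> @ [seg]) q"
        using free off(3) unfolding shortcut_free_def by (metis not_le)
      then have "gdist C (Vertex p) z \<le> path_length \<tau> + \<bar>t - s\<bar>"
        using path tr off(2) q True by (auto simp: strict_shortcut_def shortcut_def seg)
      then show ?thesis
        using cyc.gdist_triangle[OF x Vertex_in[OF off(2)] True] off(6) True len by auto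
    next
      case False
      then show ?thesis
        using off path tr len by (intro disjI2 conjI exI[of _ p] exI[of _ "\<tau> @ [seg]"]) (auto simp: seg)
    qed
  qed
qed

lemma geodesic_far_from_shortcuts:
  assumes x: "x \<in> points C" and y: "y \<in> points C"
    and free: "shortcut_free x \<rho>"
  shows "(\<exists>v\<in>points C. \<rho> \<le> gdist C x v \<and> gdist C x v + gdist G v y \<le> gdist G x y) \<or>
    gdist C x y \<le> gdist G x y"
proof -
  obtain \<sigma> where "path_between G x \<sigma> y" "path_length \<sigma> = gdist G x y"
    using shortest_path_exists x y cycle_points_subset by blast
  then show ?thesis using path_far_from_shortcuts[OF x free, of \<sigma> y] y by auto
qed

text \<open>If a shortest path gets far from \<open>x\<close>, it has already used length
  \<open>\<rho>\<close>, which is at least the cycle distance to \<open>y\<close>.\<close>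

lemma gdist_eq_cycle_dist:
  assumes x: "x \<in> points C" and y: "y \<in> points C"
    and free: "shortcut_free x \<rho>"
    and "gdist C x y \<le> \<rho>"
  shows "gdist G x y = gdist C x y"
proof -
  have "gdist C x y \<le> gdist G x y"
    using geodesic_far_from_shortcuts[OF x y free]
  proof (elim disjE bexE conjE)
    fix v assume v: "v \<in> points C" "\<rho> \<le> gdist C x v" "gdist C x v + gdist G v y \<le> gdist G x y"
    have "0 \<le> gdist G v y" using gdist_nonneg v(1) y cycle_points_subset by blast
    with v assms(4) show ?thesis by linarith
  qed
  then show ?thesis using gdist_le_cycle_dist[OF x y] by linarith
qed

lemma continuous_gdist_loop:
  assumes "p \<in> points G"
  shows "continuous_on A (\<lambda>u. gdist G p (loop u))"
proof -
  have "\<bar>gdist G p (loop u) - gdist G p (loop v)\<bar> \<le> \<bar>u - v\<bar>" for u v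
  proof -
    have uv: "loop u \<in> points G" "loop v \<in> points G" using loop_in_points cycle_points_subset by auto
    have "gdist G (loop u) (loop v) \<le> \<bar>u - v\<bar>"
      using gdist_le_cycle_dist[OF loop_in_points loop_in_points] cycle_dist_le order_trans by blast
    then show ?thesis
      using gdist_triangle[OF assms uv] gdist_triangle[OF assms uv(2,1)] gdist_commute[OF uv] by linarith
  qed
  then have "uniformly_continuous_on A (\<lambda>u. gdist G p (loop u))"
    unfolding uniformly_continuous_on_def dist_real_def by (meson le_less_trans)
  then show ?thesis by (rule uniformly_continuous_imp_continuous)
qed

section \<open>Strict shortcuts near every point of a long cycle\<close>

lemma strict_shortcut_near:
  assumes hyp: "hyperbolic (points G) (gdist G) \<delta>" and t: "0 \<le> \<delta>" "\<delta> < t" "4 * t \<le> L"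
    and x: "x \<in> points C"
  obtains p \<tau> q where "strict_shortcut G c p \<tau> q" "gdist C x (Vertex p) < 3 * t"
proof (rule ccontr)
  assume "\<not> thesis"
  then have free: "shortcut_free x (3 * t)"
    using that unfolding shortcut_free_def by (meson not_le)
  obtain s where s: "x = loop s" using loop_surj[OF x] .
  define a b where "a = loop (s + t)" and "b = loop (s - t)"
  have C: "a \<in> points C" "b \<in> points C" by (auto simp: a_def b_def loop_in_points)
  have G: "x \<in> points G" "a \<in> points G" "b \<in> points G" using x C cycle_points_subset by auto
  have tpos: "0 < t" using t by simp
  \<comment> \<open>By \<open>4 * t \<le> L\<close> the arc of length \<open>2 * t\<close> from
    \<open>a\<close> to \<open>b\<close> through \<open>x\<close> is no longer than its
    complement.\<close>
  have xa: "gdist C x a = t" "gdist C x b = t" and ab: "gdist C a b = 2 * t"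
    using cycle_dist_le[of s "s + t"] cycle_dist_ge[of t s "s + t"]
      cycle_dist_le[of s "s - t"] cycle_dist_ge[of t s "s - t"]
      cycle_dist_le[of "s + t" "s - t"] cycle_dist_ge[of "2 * t" "s + t" "s - t"] t tpos
    by (auto simp: a_def b_def s)
  have Gxa: "gdist G x a = t" "gdist G x b = t"
    using gdist_eq_cycle_dist[OF x C(1) free] gdist_eq_cycle_dist[OF x C(2) free] xa tpos by auto
  have "gdist G a b = gdist C a b"
  proof (rule gdist_eq_cycle_dist[OF C])
    \<comment> \<open>Moving the centre from \<open>x\<close> to \<open>a\<close> costs
      \<open>t\<close> of the radius \<open>3 * t\<close>; what remains is just the cycle distance
      from \<open>a\<close> to \<open>b\<close>.\<close>
    show "shortcut_free a (2 * t)" unfolding shortcut_free_def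
    proof (intro allI impI)
      fix p \<tau> q assume sc: "strict_shortcut G c p \<tau> q"
      then have "Vertex p \<in> points C" by (auto simp: strict_shortcut_def shortcut_def points_def)
      moreover have "3 * t \<le> gdist C x (Vertex p)" using free sc by (auto simp: shortcut_free_def)
      ultimately show "2 * t \<le> gdist C a (Vertex p)"
        using cyc.gdist_triangle[OF x C(1), of "Vertex p"] xa(1) by simp
    qed
  qed (simp add: ab)
  then have Gab: "gdist G a b = 2 * t" using ab by simp
  have free_t: "shortcut_free x t" using free tpos unfolding shortcut_free_def by force
  have split: "gdist G x a + gdist G a y = gdist G x y \<or> gdist G x b + gdist G b y = gdist G x y"
    if u: "y = loop (s + u)" "t \<le> u" "u \<le> L - t" for y u
  proof -
    have y: "y \<in> points C" "y \<in> points G" using u(1) loop_in_points cycle_points_subset by auto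
    have "t \<le> gdist C x y" using cycle_dist_ge[of t s "s + u"] u tpos s by simp
    \<comment> \<open>If the cycle metric is not beaten at \<open>y\<close> at all,
      \<open>v = y\<close> works.\<close>
    then obtain v where v: "v \<in> points C" "t \<le> gdist C x v" "gdist C x v + gdist G v y \<le> gdist G x y"
      using geodesic_far_from_shortcuts[OF x y(1) free_t] gdist_self[OF y(2)] y(1)
      by (metis add.right_neutral)
    have vG: "v \<in> points G" using v(1) cycle_points_subset by blast
    obtain w0 where w0: "v = loop w0" using loop_surj[OF v(1)] .
    obtain k where k: "gdist C x v = \<bar>s - w0 - L * of_int k\<bar>"
      using cycle_dist_attained[of s w0] s w0 by metis
    \<comment> \<open>This lift of \<open>v\<close> realizes the cycle distance to \<open>x\<close>.
      It is at least \<open>t\<close> away from \<open>s\<close>, so the arc towards it passes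
      through \<open>a\<close> or \<open>b\<close>.\<close>
    define w where "w = w0 + L * of_int k"
    have w: "v = loop w" "gdist C x v = \<bar>s - w\<bar>" using w0 k by (auto simp: w_def loop_periodic)
    have "gdist C a v \<le> \<bar>s + t - w\<bar>" "gdist C b v \<le> \<bar>s - t - w\<bar>"
      using cycle_dist_le w(1) by (auto simp: a_def b_def)
    then have "gdist G a v + t \<le> gdist C x v \<or> gdist G b v + t \<le> gdist C x v"
      using gdist_le_cycle_dist[OF C(1) v(1)] gdist_le_cycle_dist[OF C(2) v(1)] w(2) v(2) tpos by linarith
    then have "gdist G a y + t \<le> gdist G x y \<or> gdist G b y + t \<le> gdist G x y"
      using gdist_triangle[OF G(2) vG y(2)] gdist_triangle[OF G(3) vG y(2)] v(3) by linarith
    then show ?thesis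
      using gdist_triangle[OF G(1,2) y(2)] gdist_triangle[OF G(1,3) y(2)] Gxa by linarith
  qed
  \<comment> \<open>On the arc from \<open>a\<close> to \<open>b\<close> avoiding \<open>x\<close>,
    \<open>h\<close> falls from \<open>2 * t\<close> to \<open>- 2 * t\<close>; a zero is a point
    equidistant from \<open>a\<close> and \<open>b\<close>.\<close>
  define h where "h u = gdist G b (loop u) - gdist G a (loop u)" for u
  have "loop (s + (L - t)) = b" using loop_periodic[of "s - t" 1] by (simp add: b_def algebra_simps)
  then have "h (s + (L - t)) \<le> 0" "0 \<le> h (s + t)"
    using Gab gdist_commute[OF G(2,3)] gdist_self[OF G(2)] gdist_self[OF G(3)] tpos
    by (simp_all add: h_def flip: a_def)
  moreover have "continuous_on {s + t..s + (L - t)} h"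
    unfolding h_def by (intro continuous_on_diff continuous_gdist_loop G)
  ultimately obtain w where w: "s + t \<le> w" "w \<le> s + (L - t)" "h w = 0"
    using IVT2'[of h "s + (L - t)" 0 "s + t"] t tpos by auto
  define y where "y = loop w"
  have y: "y \<in> points G" using loop_in_points cycle_points_subset by (auto simp: y_def)
  have "gdist G b y = gdist G a y" using w(3) by (simp add: h_def y_def)
  then have "gdist G x a + gdist G a y = gdist G x y" "gdist G x b + gdist G b y = gdist G x y"
    using split[of y "w - s"] w Gxa by (auto simp: y_def)
  then have "gdist G a b \<le> 2 * \<delta>"
    using hyperbolic_bigon[OF hyp G(1) y G(2,3)] Gxa by simp
  then show False using Gab t by simp
qed

text \<open>A cycle has finitely many pairs of vertices. One chosen path per pair keeps the family
  finite even where infinitely many strict shortcuts join the same pair.\<close>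

lemma finite_strict_shortcuts_dense:
  assumes near: "\<And>x. x \<in> points C \<Longrightarrow>
      \<exists>p \<tau> q. strict_shortcut G c p \<tau> q \<and> gdist C x (Vertex p) < \<epsilon>"
  shows "\<exists>\<Sigma>. finite \<Sigma> \<and> (\<forall>(p, \<sigma>, q)\<in>\<Sigma>. strict_shortcut G c p \<sigma> q) \<and>
    eps_dense (points C) (gdist C) \<epsilon> (\<Union>(p, \<sigma>, q)\<in>\<Sigma>. {Vertex p, Vertex q})"
proof -
  define P where "P = {(p, q). \<exists>\<sigma>. strict_shortcut G c p \<sigma> q}"
  define \<Sigma> where "\<Sigma> = (\<lambda>(p, q). (p, SOME \<sigma>. strict_shortcut G c p \<sigma> q, q)) ` P"
  have "P \<subseteq> verts C \<times> verts C" by (auto simp: P_def strict_shortcut_def shortcut_def)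
  then have "finite P" by (rule finite_subset) simp
  then have "finite \<Sigma>" by (simp add: \<Sigma>_def)
  moreover have \<Sigma>: "strict_shortcut G c p \<sigma> q" if "(p, \<sigma>, q) \<in> \<Sigma>" for p \<sigma> q
    using that by (auto simp: \<Sigma>_def P_def intro: someI)
  moreover have "eps_dense (points C) (gdist C) \<epsilon> (\<Union>(p, \<sigma>, q)\<in>\<Sigma>. {Vertex p, Vertex q})"
    unfolding eps_dense_def
  proof (intro conjI ballI)
    show "(\<Union>(p, \<sigma>, q)\<in>\<Sigma>. {Vertex p, Vertex q}) \<subseteq> points C"
      using \<Sigma> by (fastforce simp: strict_shortcut_def shortcut_def points_def)
  next
    fix x assume x: "x \<in> points C"
    then obtain p \<tau> q where sc: "strict_shortcut G c p \<tau> q" "gdist C x (Vertex p) < \<epsilon>"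
      using near by blast
    then have "Vertex p \<in> points C" by (auto simp: strict_shortcut_def shortcut_def points_def)
    then have "gdist C (Vertex p) x < \<epsilon>" using sc(2) cyc.gdist_commute[OF x] by simp
    moreover have "(p, SOME \<sigma>. strict_shortcut G c p \<sigma> q, q) \<in> \<Sigma>"
      using sc(1) by (auto simp: \<Sigma>_def P_def)
    ultimately show "\<exists>a\<in>\<Union>(p, \<sigma>, q)\<in>\<Sigma>. {Vertex p, Vertex q}. gdist C a x < \<epsilon>" by blast
  qed
  ultimately show ?thesis by blast
qed

end

lemma geodesic_graphI:
  assumes mg: "metric_graph G" and con: "connected_graph G"
  shows "geodesic_graph G"
proof -
  have "\<forall>e\<in>edges G. tail G e \<in> verts G \<and> head G e \<in> verts G \<and> 0 < elen G e"
    using mg unfolding metric_graph_def by (rule conjunct1)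
  then interpret length_graph G
    using con by unfold_locales blast
  show ?thesis
  proof
    fix x y assume xy: "x \<in> points G" "y \<in> points G"
    then obtain \<sigma> where \<sigma>: "path_between G x \<sigma> y"
      "\<And>\<tau>. path_between G x \<tau> y \<Longrightarrow> path_length \<sigma> \<le> path_length \<tau>"
      using mg con unfolding metric_graph_def connected_graph_def by metis
    then have "path_length \<sigma> = gdist G x y"
      using gdist_le_path_length[OF \<sigma>(1)] le_gdist[OF xy, of "path_length \<sigma>"] by force
    with \<sigma>(1) show "\<exists>\<sigma>. path_between G x \<sigma> y \<and> path_length \<sigma> = gdist G x y" by blast
  qed
qed

theorem theorem2p8:
  fixes G :: "('v, 'e) mgraph" and \<delta> :: real
  assumes "metric_graph G"
    and "connected_graph G"
    and "locally_finite_graph G"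
    and "\<delta> \<ge> 0"
    and "hyperbolic (points G) (gdist G) \<delta>"
  shows "\<exists>\<epsilon>>0. \<exists>k\<ge>0. densely_path_chordal G \<epsilon> k"
proof -
  \<comment> \<open>Any \<open>t > \<delta>\<close> would do; since \<open>\<delta> \<ge> 0\<close>,
    this one is positive.\<close>
  define t where "t = \<delta> + 1"
  have "densely_path_chordal G (3 * t) (4 * t)"
    unfolding densely_path_chordal_def
  proof (intro allI impI, elim conjE)
    fix c assume c: "is_cycle G c" "4 * t \<le> cycle_length G c"
    interpret geodesic_graph G using assms(1,2) by (rule geodesic_graphI)
    interpret geodesic_graph_cycle G c by unfold_locales (rule c(1))
    show "\<exists>\<Sigma>. finite \<Sigma> \<and> (\<forall>(p, \<sigma>, q)\<in>\<Sigma>. strict_shortcut G c p \<sigma> q) \<and>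
        eps_dense (points C) (gdist C) (3 * t) (\<Union>(p, \<sigma>, q)\<in>\<Sigma>. {Vertex p, Vertex q})"
    proof (rule finite_strict_shortcuts_dense)
      fix x assume "x \<in> points C"
      moreover have "\<delta> < t" by (simp add: t_def)
      ultimately show "\<exists>p \<tau> q. strict_shortcut G c p \<tau> q \<and> gdist C x (Vertex p) < 3 * t"
        using strict_shortcut_near[OF assms(5,4) _ c(2)] by metis
    qed
  qed
  moreover have "0 < 3 * t" "0 \<le> 4 * t" using assms(4) by (simp_all add: t_def)
  ultimately show ?thesis by blast
qed

end
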